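(* For every $n\ge 2$ and $\epsilon>0$, the set $\{P_\tau:\tau\in S_n\}\subset\mathbb{U}_N$ of qubit-permutation operators can be $\epsilon$-tested with query complexity $O(n\log n/\epsilon^2)$, with implied constant independent of $n$ and $\epsilon$.
   Context: $N=2^n$, $\mathbb{U}_N$ the $N\times N$ unitaries, $S_n$ the symmetric group on $\{1,\dots,n\}$, and for $\tau\in S_n$, $P_\tau|i_1,\dots,i_n\rangle=|i_{\tau(1)},\dots,i_{\tau(n)}\rangle$ for $i_j\in\{0,1\}$. $\|A\|=\sqrt{\mathrm{tr}(A^\dagger A)}$; $D(A,B)=\min_{\theta\in[0,2\pi)}\frac{1}{\sqrt{2N}}\|e^{i\theta}A-B\|$. For $\mathcal{S}\subseteq\mathbb{U}_N$, $U$ has property $\mathcal{S}$ if $U=e^{i\theta}V$ for some $V\in\mathcal{S}$, real $\theta$; $U$ is $\epsilon$-far from $\mathcal{S}$ if $D(U,V)\ge\epsilon$ for all $V\in\mathcal{S}$. Testing model: the unknown $U\in\mathbb{U}_N$ is a black box; the algorithm may prepare arbitrary states on the system plus an ancilla, apply $U\otimes I$ (one query each), interleaved with arbitrary fixed quantum operations, and measure. It $\epsilon$-tests $\mathcal{S}$ if for every $U\in\mathbb{U}_N$ it accepts with probability $\ge2/3$ when $U$ has property $\mathcal{S}$ and with probability $\le1/3$ when $U$ is $\epsilon$-far from $\mathcal{S}$. *)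

theory Defs
  imports "Jordan_Normal_Form.Matrix" "HOL-Combinatorics.Permutations" Complex_Main
begin

definition adj :: "complex mat \<Rightarrow> complex mat" where
  "adj A = mat (dim_col A) (dim_row A) (\<lambda>(i,j). cnj (A $$ (j,i)))"

definition unitaries :: "nat \<Rightarrow> complex mat set" where
  "unitaries N = {U. U \<in> carrier_mat N N \<and> U * adj U = 1\<^sub>m N \<and> adj U * U = 1\<^sub>m N}"

definition mtrace :: "complex mat \<Rightarrow> complex" where
  "mtrace A = (\<Sum>i<dim_row A. A $$ (i,i))"

definition frob :: "complex mat \<Rightarrow> real" where
  "frob A = sqrt (Re (mtrace (adj A * A)))"

text \<open>D(A,B) = min over theta in [0,2pi) of ||e^{i theta} A - B|| / sqrt(2N).
  The minimum is attained (continuity + periodicity), so it equals the infimum.\<close>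
definition Dist :: "nat \<Rightarrow> complex mat \<Rightarrow> complex mat \<Rightarrow> real" where
  "Dist N A B = (INF \<theta>\<in>{0..<2*pi}. frob (exp (\<i> * complex_of_real \<theta>) \<cdot>\<^sub>m A - B) / sqrt (2 * real N))"

definition has_property :: "complex mat set \<Rightarrow> complex mat \<Rightarrow> bool" where
  "has_property S U \<longleftrightarrow> (\<exists>V\<in>S. \<exists>\<theta>::real. U = exp (\<i> * complex_of_real \<theta>) \<cdot>\<^sub>m V)"

definition eps_far :: "nat \<Rightarrow> real \<Rightarrow> complex mat set \<Rightarrow> complex mat \<Rightarrow> bool" where
  "eps_far N \<epsilon> S U \<longleftrightarrow> (\<forall>V\<in>S. Dist N U V \<ge> \<epsilon>)"

text \<open>Bits of a basis index x in {0..<2^n}: bit k (k = 1..n) is i_k, with i_1 the most significant.\<close>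
definition qbit :: "nat \<Rightarrow> nat \<Rightarrow> nat \<Rightarrow> nat" where
  "qbit n x k = (x div 2 ^ (n - k)) mod 2"

text \<open>P_tau |i_1..i_n> = |i_{tau 1} .. i_{tau n}>: entry (r,c) is 1 iff bit k of r equals bit tau(k) of c.\<close>
definition perm_op :: "nat \<Rightarrow> (nat \<Rightarrow> nat) \<Rightarrow> complex mat" where
  "perm_op n \<tau> = mat (2^n) (2^n)
     (\<lambda>(r,c). if (\<forall>k\<in>{1..n}. qbit n r k = qbit n c (\<tau> k)) then 1 else 0)"

definition qubit_perms :: "nat \<Rightarrow> complex mat set" where
  "qubit_perms n = {perm_op n \<tau> | \<tau>. \<tau> permutes {1..n}}"

definition kron :: "complex mat \<Rightarrow> complex mat \<Rightarrow> complex mat" where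
  "kron A B = mat (dim_row A * dim_row B) (dim_col A * dim_col B)
     (\<lambda>(i,j). A $$ (i div dim_row B, j div dim_col B) * B $$ (i mod dim_row B, j mod dim_col B))"

text \<open>A general query algorithm (purified form): ancilla dimension d, initial unit state psi on
  system (dimension N) tensor ancilla, list Vs of fixed unitaries on the joint system; each element
  of Vs is preceded by one query U tensor I; final two-outcome projective measurement with
  accept projector E.  Arbitrary quantum operations / intermediate measurements / mixed states
  reduce to this form by Stinespring dilation, deferred measurement and purification
  (with a large enough ancilla), and POVMs reduce to projective measurements (Naimark).\<close>
record alg =
  anc_dim :: nat
  init_state :: "complex vec"
  ops :: "complex mat list"
  accept_proj :: "complex mat"

definition num_queries :: "alg \<Rightarrow> nat" where
  "num_queries A = length (ops A)"

definition valid_alg :: "nat \<Rightarrow> alg \<Rightarrow> bool" where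
  "valid_alg N A \<longleftrightarrow>
     anc_dim A \<ge> 1 \<and>
     init_state A \<in> carrier_vec (N * anc_dim A) \<and>
     init_state A \<bullet>c init_state A = 1 \<and>
     (\<forall>V\<in>set (ops A). V \<in> unitaries (N * anc_dim A)) \<and>
     accept_proj A \<in> carrier_mat (N * anc_dim A) (N * anc_dim A) \<and>
     adj (accept_proj A) = accept_proj A \<and>
     accept_proj A * accept_proj A = accept_proj A"

definition final_state :: "alg \<Rightarrow> complex mat \<Rightarrow> complex vec" where
  "final_state A U =
     foldl (\<lambda>\<phi> V. V *\<^sub>v (kron U (1\<^sub>m (anc_dim A)) *\<^sub>v \<phi>)) (init_state A) (ops A)"

definition accept_prob :: "alg \<Rightarrow> complex mat \<Rightarrow> real" where
  "accept_prob A U = (let \<phi> = final_state A U in Re ((accept_proj A *\<^sub>v \<phi>) \<bullet>c \<phi>))"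

definition eps_tests :: "nat \<Rightarrow> real \<Rightarrow> complex mat set \<Rightarrow> alg \<Rightarrow> bool" where
  "eps_tests N \<epsilon> S A \<longleftrightarrow> valid_alg N A \<and>
     (\<forall>U\<in>unitaries N.
        (has_property S U \<longrightarrow> accept_prob A U \<ge> 2/3) \<and>
        (eps_far N \<epsilon> S U \<longrightarrow> accept_prob A U \<le> 1/3))"

end

theory Submission
  imports Defs
begin

text \<open>
  Query \<open>U\<close> on the \<open>n\<close> basis states with exactly one qubit set, and \<open>k\<close> times, with
  \<open>k \<ge> 1 / \<epsilon>\<^sup>2\<close>, on half of a maximally entangled state. If \<open>U = e\<^sup>i\<^sup>\<theta> P\<^sub>\<tau>\<close>, the \<open>n\<close> basis
  outputs \<open>y\<close> determine \<open>\<tau>\<close>. The test measures \<open>y\<close> and accepts iff the \<open>k\<close> remaining registers all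
  project onto the Choi state of the permutation \<open>T y\<close> guessed from \<open>y\<close>; the accept projector is
  therefore block diagonal in \<open>y\<close> with rank-one blocks. It accepts with certainty when \<open>U\<close> has the
  property. Since \<open>D(U, V)\<^sup>2 = 1 - |tr(V\<^sup>\<dagger> U)| / N\<close>, a far \<open>U\<close> passes with probability at most
  \<open>(1 - \<epsilon>\<^sup>2)\<^bsup>2k\<^esup> \<le> 1 / 3\<close> whatever permutation is guessed. The \<open>n + k\<close> queries stay within the
  claimed bound; no unitary is \<open>\<epsilon>\<close>-far when \<open>\<epsilon> > 1\<close>.

  In the query model only the leading register meets \<open>U\<close>, so a cyclic rotation of the registers
  follows each query. After \<open>n + k\<close> rotations every register is back in its place.
\<close>

section \<open>Indices and entries\<close>

lemma sum_lessThan_mult: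
  fixes f :: "nat \<Rightarrow> 'a::comm_monoid_add"
  shows "(\<Sum>i<m * n. f i) = (\<Sum>a<m. \<Sum>b<n. f (a * n + b))"
proof -
  have "sum f {a * n..<a * n + n} = (\<Sum>b<n. f (a * n + b))" for a
    using sum.shift_bounds_nat_ivl[of f 0 "a * n" n]
    by (simp add: add.commute lessThan_atLeast0)
  then show ?thesis
    using sum.nat_group[of f n m] by simp
qed

lemma digits_less: "a < m \<Longrightarrow> b < n \<Longrightarrow> a * n + b < m * (n::nat)"
proof -
  assume "a < m" "b < n"
  then have "a * n + b < (a + 1) * n" by simp
  also have "\<dots> \<le> m * n" using \<open>a < m\<close> by (intro mult_le_mono1) simp
  finally show ?thesis .
qed

lemma mult_mat_vec_entry:
  assumes "A \<in> carrier_mat m n" "v \<in> carrier_vec n" "i < m"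
  shows "(A *\<^sub>v v) $ i = (\<Sum>j<n. A $$ (i, j) * v $ j)"
  using assms by (simp add: scalar_prod_def lessThan_atLeast0)

lemma mult_mat_entry:
  assumes "A \<in> carrier_mat l m" "B \<in> carrier_mat m n" "i < l" "j < n"
  shows "(A * B) $$ (i, j) = (\<Sum>k<m. A $$ (i, k) * B $$ (k, j))"
  using assms by (simp add: scalar_prod_def lessThan_atLeast0)

lemma cscalar_prod_sum:
  fixes v w :: "complex vec"
  assumes "v \<in> carrier_vec n" "w \<in> carrier_vec n"
  shows "v \<bullet>c w = (\<Sum>i<n. v $ i * cnj (w $ i))"
  using assms by (simp add: scalar_prod_def lessThan_atLeast0 conjugate_complex_def)

section \<open>Pure tensors\<close>

text \<open>Base-\<open>D\<close> digits of the index select the registers, the head of the list belonging to the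
  least significant digit.\<close>

fun tensor :: "nat \<Rightarrow> (nat \<Rightarrow> complex) list \<Rightarrow> nat \<Rightarrow> complex" where
  "tensor D [] i = 1"
| "tensor D (h # hs) i = h (i mod D) * tensor D hs (i div D)"

lemma tensor_append:
  "tensor D (hs @ gs) i =
    tensor D hs (i mod D ^ length hs) * tensor D gs (i div D ^ length hs)"
proof (induction hs arbitrary: i)
  case (Cons h hs)
  have "i mod (D * D ^ length hs) div D = i div D mod D ^ length hs"
    by (cases "D = 0") (auto simp: mod_mult2_eq)
  moreover have "i mod (D * D ^ length hs) mod D = i mod D"
    by (simp add: mod_mod_cancel)
  ultimately show ?case
    using Cons by (simp add: div_mult2_eq mult.assoc)
qed simp

text \<open>Peeling off the lowest digit factors both tensors, so the sum over indices splits into a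
  product of sums over single digits.\<close>

lemma tensor_inner:
  assumes "length gs = length hs"
  shows "(\<Sum>i<D ^ length hs. cnj (tensor D gs i) * tensor D hs i) =
    (\<Prod>(g, h)\<leftarrow>zip gs hs. \<Sum>w<D. cnj (g w) * h w)"
  using assms
proof (induction gs hs rule: list_induct2)
  case (Cons g gs h hs)
  have "(\<Sum>i<D ^ length hs * D. cnj (tensor D (g # gs) i) * tensor D (h # hs) i) =
    (\<Sum>b<D ^ length hs. \<Sum>w<D. (cnj (g w) * h w) * (cnj (tensor D gs b) * tensor D hs b))"
    unfolding sum_lessThan_mult by (intro sum.cong refl) (simp add: mult_ac)
  also have "\<dots> = (\<Sum>w<D. cnj (g w) * h w) * (\<Sum>b<D ^ length hs. cnj (tensor D gs b) * tensor D hs b)"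
    by (simp add: sum_product sum.swap[of _ "{..<D}"])
  finally show ?case
    using Cons by (simp add: mult.commute)
qed simp

lemma tensor_norm:
  assumes "\<And>h. h \<in> set hs \<Longrightarrow> (\<Sum>w<D. cnj (h w) * h w) = 1"
  shows "(\<Sum>i<D ^ length hs. cnj (tensor D hs i) * tensor D hs i) = 1"
proof -
  have "(\<Prod>(g, h)\<leftarrow>zip hs hs. \<Sum>w<D. cnj (g w) * h w) = 1"
    using assms by (induction hs) auto
  then show ?thesis by (simp add: tensor_inner)
qed

lemma tensor_inner_replicate:
  "(\<Sum>i<D ^ k. cnj (tensor D (replicate k g) i) * tensor D (replicate k h) i) =
    (\<Sum>w<D. cnj (g w) * h w) ^ k"
  using tensor_inner[of "replicate k g" "replicate k h" D] by (simp add: prod_list_replicate)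

text \<open>A nonzero product has only nonzero factors, and both tensors evaluate the factor of
  \<open>j\<close> at the same digit of \<open>i\<close>; that digit is the witness.\<close>

lemma tensor_common_support:
  assumes "tensor D (map f js) i \<noteq> 0" "tensor D (map g js) i \<noteq> 0" "j \<in> set js" "D > 0"
  shows "\<exists>w<D. f j w \<noteq> 0 \<and> g j w \<noteq> 0"
  using assms
proof (induction js arbitrary: i)
  case (Cons a js)
  show ?case
  proof (cases "j = a")
    case True
    then show ?thesis
      using Cons.prems by (intro exI[of _ "i mod D"]) auto
  next
    case False
    then show ?thesis
      using Cons.prems by (intro Cons.IH[of "i div D"]) auto
  qed
qed simp

section \<open>Queries on registers\<close>

text \<open>A register of dimension \<open>N * N\<close> pairs the system (high digit) with a reference (low digit).\<close>

definition reg_apply :: "nat \<Rightarrow> complex mat \<Rightarrow> (nat \<Rightarrow> complex) \<Rightarrow> nat \<Rightarrow> complex" where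
  "reg_apply N U h w = (\<Sum>a<N. U $$ (w div N, a) * h (a * N + w mod N))"

text \<open>The inverse of the register rotation on indices: it moves the lowest of
  \<open>l + 1\<close> base-\<open>D\<close> digits to the top, giving the source index from which
  the rotated vector reads its entry \<open>r\<close>.\<close>

definition unrot :: "nat \<Rightarrow> nat \<Rightarrow> nat \<Rightarrow> nat" where
  "unrot D l r = (r mod D) * D ^ l + r div D"

definition select_mat :: "nat \<Rightarrow> (nat \<Rightarrow> nat) \<Rightarrow> complex mat" where
  "select_mat m f = mat m m (\<lambda>(r, c). if c = f r then 1 else 0)"

lemma select_mat_unitary:
  assumes "bij_betw f {..<m} {..<m}"
  shows "select_mat m f \<in> unitaries m"
proof -
  have lt: "f r < m" if "r < m" for r
    using assms that by (auto dest: bij_betwE)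
  have inj: "f r = f s \<longleftrightarrow> r = s" if "r < m" "s < m" for r s
    using assms that by (auto simp: bij_betw_def inj_on_def)
  have car: "select_mat m f \<in> carrier_mat m m" "adj (select_mat m f) \<in> carrier_mat m m"
    by (auto simp: select_mat_def adj_def)
  have "select_mat m f * adj (select_mat m f) = 1\<^sub>m m"
  proof (rule eq_matI)
    fix i j assume "i < dim_row (1\<^sub>m m)" "j < dim_col (1\<^sub>m m)"
    then have ij: "i < m" "j < m" by auto
    have "(select_mat m f * adj (select_mat m f)) $$ (i, j) =
      (\<Sum>k<m. if k = f i then (if f i = f j then 1 else 0) else 0)"
      unfolding mult_mat_entry[OF car ij]
      using ij by (intro sum.cong) (auto simp: select_mat_def adj_def)
    then show "(select_mat m f * adj (select_mat m f)) $$ (i, j) = 1\<^sub>m m $$ (i, j)"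
      using ij lt[of i] inj[of i j] by simp
  qed (use car in auto)
  moreover have "adj (select_mat m f) * select_mat m f = 1\<^sub>m m"
  proof (rule eq_matI)
    fix i j assume "i < dim_row (1\<^sub>m m)" "j < dim_col (1\<^sub>m m)"
    then have ij: "i < m" "j < m" by auto
    have "(adj (select_mat m f) * select_mat m f) $$ (i, j) =
      (\<Sum>k<m. (\<lambda>c. if c = i then (if i = j then 1 else 0) else 0) (f k))"
      unfolding mult_mat_entry[OF car(2,1) ij]
      using ij by (intro sum.cong) (auto simp: select_mat_def adj_def)
    also have "\<dots> = (\<Sum>c<m. if c = i then (if i = j then 1 else 0) else 0)"
      by (rule sum.reindex_bij_betw[OF assms])
    finally show "(adj (select_mat m f) * select_mat m f) $$ (i, j) = 1\<^sub>m m $$ (i, j)"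
      using ij by simp
  qed (use car in auto)
  ultimately show ?thesis
    using car by (simp add: unitaries_def)
qed

lemma select_mat_mult_vec:
  assumes "v \<in> carrier_vec m" "r < m" "f r < m"
  shows "(select_mat m f *\<^sub>v v) $ r = v $ f r"
proof -
  have "(select_mat m f *\<^sub>v v) $ r = (\<Sum>j<m. if j = f r then v $ f r else 0)"
    using assms
    by (subst mult_mat_vec_entry[of _ m m]) (auto simp: select_mat_def if_distrib[of "\<lambda>c. c * _"] cong: if_cong)
  then show ?thesis using assms by simp
qed

lemma unrot_less: "D > 0 \<Longrightarrow> r < D ^ Suc l \<Longrightarrow> unrot D l r < D ^ Suc l"
  using digits_less[of "r mod D" D "r div D" "D ^ l"]
  by (simp add: unrot_def less_mult_imp_div_less mult.commute)

text \<open>Division and remainder by \<open>D ^ l\<close> recover both digit blocks of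
  \<open>r\<close>, so the map is injective, and an injective self-map of a finite set is
  onto.\<close>

lemma unrot_bij:
  assumes "D > 0"
  shows "bij_betw (unrot D l) {..<D ^ Suc l} {..<D ^ Suc l}"
proof -
  have "r = s" if "r < D ^ Suc l" "s < D ^ Suc l" "unrot D l r = unrot D l s" for r s
  proof -
    have "unrot D l r div D ^ l = r mod D" "unrot D l r mod D ^ l = r div D"
      if "r < D ^ Suc l" for r
    proof -
      have "r div D < D ^ l"
        using that by (simp add: less_mult_imp_div_less mult.commute)
      then show "unrot D l r div D ^ l = r mod D" "unrot D l r mod D ^ l = r div D"
        using assms by (auto simp: unrot_def)
    qed
    then have "r mod D = s mod D" "r div D = s div D"
      using that by metis+
    then show ?thesis by (metis div_mult_mod_eq)
  qed
  then have "inj_on (unrot D l) {..<D ^ Suc l}"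
    by (auto simp: inj_on_def)
  moreover have "unrot D l ` {..<D ^ Suc l} \<subseteq> {..<D ^ Suc l}"
    using unrot_less[OF assms] by auto
  ultimately show ?thesis
    by (simp add: bij_betw_def endo_inj_surj)
qed

lemma kron_id_mult_vec:
  assumes "U \<in> carrier_mat N N" "v \<in> carrier_vec (N * d)" "i < N * d"
  shows "(kron U (1\<^sub>m d) *\<^sub>v v) $ i = (\<Sum>a<N. U $$ (i div d, a) * v $ (a * d + i mod d))"
proof -
  have d: "d > 0" using assms(3) by (cases d) auto
  have K: "kron U (1\<^sub>m d) \<in> carrier_mat (N * d) (N * d)"
    using assms by (auto simp: kron_def)
  have "(kron U (1\<^sub>m d) *\<^sub>v v) $ i =
    (\<Sum>a<N. \<Sum>b<d. kron U (1\<^sub>m d) $$ (i, a * d + b) * v $ (a * d + b))"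
    by (simp only: mult_mat_vec_entry[OF K assms(2,3)] sum_lessThan_mult)
  also have "\<dots> = (\<Sum>a<N. \<Sum>b<d. if b = i mod d then U $$ (i div d, a) * v $ (a * d + i mod d) else 0)"
    using assms d by (intro sum.cong refl) (auto simp: kron_def digits_less)
  also have "\<dots> = (\<Sum>a<N. U $$ (i div d, a) * v $ (a * d + i mod d))"
    using d by (intro sum.cong) auto
  finally show ?thesis .
qed

text \<open>The last list entry \<open>h\<close> owns the top digit. Its system half is what
  \<open>U\<close> meets, while its reference half and the other \<open>l\<close> registers form the
  ancilla of dimension \<open>N * D ^ l\<close>. The rotation then brings the result to the lowest
  digit.\<close>

lemma query_and_rotate:
  assumes U: "U \<in> carrier_mat N N" and N: "N > 0" and l: "length hs = l"
  defines "D \<equiv> N * N"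
  shows "select_mat (D ^ Suc l) (unrot D l) *\<^sub>v
      (kron U (1\<^sub>m (N * D ^ l)) *\<^sub>v vec (D ^ Suc l) (tensor D (hs @ [h]))) =
    vec (D ^ Suc l) (tensor D (reg_apply N U h # hs))" (is "?L = ?R")
proof (rule eq_vecI)
  let ?d = "N * D ^ l" and ?v = "vec (D ^ Suc l) (tensor D (hs @ [h]))"
  have D: "D > 0" using N by (simp add: D_def)
  have dim: "N * ?d = D ^ Suc l" by (simp add: D_def)
  fix r assume "r < dim_vec ?R"
  then have r: "r < D ^ Suc l" by simp
  let ?u = "unrot D l r" and ?w = "r mod D"
  have q: "r div D < D ^ l" using r by (simp add: less_mult_imp_div_less mult.commute)
  have u: "?u < D ^ Suc l" by (rule unrot_less[OF D r])
  have w: "?w < D" using D by simp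
  have "?u div D ^ l = ?w" using q D by (simp add: unrot_def)
  \<comment> \<open>Dropping the low \<open>l\<close> digits and then the reference half leaves the
    system half.\<close>
  then have ud: "?u div ?d = ?w div N"
    by (metis div_mult2_eq mult.commute)
  have "?w * D ^ l = (?w div N) * ?d + (?w mod N) * D ^ l"
    using arg_cong[OF div_mult_mod_eq[of ?w N], of "\<lambda>x. x * D ^ l"]
    by (simp only: add_mult_distrib mult.assoc)
  then have "?u = (?w div N) * ?d + ((?w mod N) * D ^ l + r div D)"
    by (simp add: unrot_def)
  then have um: "?u mod ?d = (?w mod N) * D ^ l + r div D"
    using ud by (metis add_left_cancel div_mult_mod_eq)
  have car: "kron U (1\<^sub>m ?d) *\<^sub>v ?v \<in> carrier_vec (D ^ Suc l)"
    using U dim by (intro carrier_vecI) (simp add: kron_def)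
  have "?L $ r = (kron U (1\<^sub>m ?d) *\<^sub>v ?v) $ ?u"
    using car r u by (intro select_mat_mult_vec)
  also have "\<dots> = (\<Sum>a<N. U $$ (?u div ?d, a) * ?v $ (a * ?d + ?u mod ?d))"
    using u by (intro kron_id_mult_vec[OF U]) (auto simp: dim)
  also have "\<dots> = (\<Sum>a<N. U $$ (?w div N, a) * (h (a * N + ?w mod N) * tensor D hs (r div D)))"
  proof (intro sum.cong refl)
    fix a assume "a \<in> {..<N}"
    then have aD: "a * N + ?w mod N < D"
      unfolding D_def using N by (intro digits_less) auto
    have e: "a * ?d + ?u mod ?d = (a * N + ?w mod N) * D ^ l + r div D"
      by (simp add: um algebra_simps)
    have "(a * N + ?w mod N) * D ^ l + r div D < D ^ Suc l"
      using digits_less[OF aD q] by simp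
    then have "?v $ (a * ?d + ?u mod ?d) = h (a * N + ?w mod N) * tensor D hs (r div D)"
      unfolding e using q l aD by (simp add: tensor_append mult.commute)
    then show "U $$ (?u div ?d, a) * ?v $ (a * ?d + ?u mod ?d) =
      U $$ (?w div N, a) * (h (a * N + ?w mod N) * tensor D hs (r div D))"
      by (simp add: ud)
  qed
  also have "\<dots> = ?R $ r"
    using r by (simp add: reg_apply_def sum_distrib_right mult.assoc)
  finally show "?L $ r = ?R $ r" .
qed (simp add: select_mat_def)

text \<open>\<open>hs\<close> collects the registers already queried and \<open>gs\<close> those
  still waiting. Each round takes the last register of \<open>gs\<close> and puts it in front of
  \<open>hs\<close>, hence the induction from the right with \<open>hs\<close> arbitrary.\<close>

lemma query_all_registers:
  assumes U: "U \<in> carrier_mat N N" and N: "N > 0" and l: "length hs + length gs = Suc l"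
  defines "D \<equiv> N * N"
  shows "foldl (\<lambda>\<phi> V. V *\<^sub>v (kron U (1\<^sub>m (N * D ^ l)) *\<^sub>v \<phi>))
      (vec (D ^ Suc l) (tensor D (hs @ gs)))
      (replicate (length gs) (select_mat (D ^ Suc l) (unrot D l))) =
    vec (D ^ Suc l) (tensor D (map (reg_apply N U) gs @ hs))"
  using l
proof (induction gs arbitrary: hs rule: rev_induct)
  case (snoc g gs)
  have "length (hs @ gs) = l" using snoc.prems by simp
  note step = query_and_rotate[OF U N this, of g, folded D_def]
  have "length (reg_apply N U g # hs) + length gs = Suc l" using snoc.prems by simp
  from snoc.IH[OF this] step show ?case by (simp del: power_Suc tensor.simps)
qed simp

section \<open>Block-diagonal projectors with rank-one blocks\<close>

text \<open>In ket notation the sum of |chi_y><chi_y| tensor |y><y|, where the low-order part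
  \<open>i mod Y\<close> of the index holds \<open>y\<close>: read \<open>y\<close>, then project
  onto a state that depends on it.\<close>

definition block_proj :: "nat \<Rightarrow> nat \<Rightarrow> (nat \<Rightarrow> nat \<Rightarrow> complex) \<Rightarrow> complex mat" where
  "block_proj Z Y \<chi> = mat (Z * Y) (Z * Y) (\<lambda>(i, j).
     if i mod Y = j mod Y then \<chi> (i mod Y) (i div Y) * cnj (\<chi> (j mod Y) (j div Y)) else 0)"

lemma block_proj_carrier: "block_proj Z Y \<chi> \<in> carrier_mat (Z * Y) (Z * Y)"
  by (simp add: block_proj_def)

lemma adj_block_proj: "adj (block_proj Z Y \<chi>) = block_proj Z Y \<chi>"
  by (rule eq_matI) (auto simp: adj_def block_proj_def)

text \<open>Only middle indices in the block of \<open>i\<close> contribute, and there the unit norm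
  of \<open>\<chi> y\<close> makes the rank-one block idempotent.\<close>

lemma block_proj_idem:
  assumes norm: "\<And>y. y < Y \<Longrightarrow> (\<Sum>z<Z. cnj (\<chi> y z) * \<chi> y z) = 1"
  shows "block_proj Z Y \<chi> * block_proj Z Y \<chi> = block_proj Z Y \<chi>"
proof (rule eq_matI)
  let ?E = "block_proj Z Y \<chi>"
  fix i j assume "i < dim_row ?E" "j < dim_col ?E"
  then have ij: "i < Z * Y" "j < Z * Y" by (auto simp: block_proj_def)
  then have Y: "Y > 0" by (cases Y) auto
  let ?c = "if i mod Y = j mod Y then \<chi> (i mod Y) (i div Y) * cnj (\<chi> (j mod Y) (j div Y)) else 0"
  have "(?E * ?E) $$ (i, j) = (\<Sum>z<Z. \<Sum>y<Y. ?E $$ (i, z * Y + y) * ?E $$ (z * Y + y, j))"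
    by (simp only: mult_mat_entry[OF block_proj_carrier block_proj_carrier ij] sum_lessThan_mult)
  also have "\<dots> = (\<Sum>z<Z. \<Sum>y<Y. if y = i mod Y
      then ?c * (cnj (\<chi> (i mod Y) z) * \<chi> (i mod Y) z) else 0)"
    using ij by (intro sum.cong refl) (auto simp: block_proj_def digits_less)
  also have "\<dots> = ?c * (\<Sum>z<Z. cnj (\<chi> (i mod Y) z) * \<chi> (i mod Y) z)"
    using Y by (simp add: sum_distrib_left)
  also have "\<dots> = ?E $$ (i, j)"
    using norm[of "i mod Y"] Y ij by (simp add: block_proj_def)
  finally show "(?E * ?E) $$ (i, j) = ?E $$ (i, j)" .
qed (auto simp: block_proj_def)

text \<open>The vector is a product of \<open>\<alpha>\<close> on the measured part and
  \<open>\<beta>\<close> on the rest. For unit vectors each term is the probability of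
  \<open>y\<close> times the acceptance probability given \<open>y\<close>.\<close>

lemma block_proj_expectation:
  assumes Y: "Y > 0"
  shows "(block_proj Z Y \<chi> *\<^sub>v vec (Z * Y) (\<lambda>i. \<alpha> (i mod Y) * \<beta> (i div Y)))
      \<bullet>c vec (Z * Y) (\<lambda>i. \<alpha> (i mod Y) * \<beta> (i div Y)) =
    (\<Sum>y<Y. (cmod (\<alpha> y))\<^sup>2 * (cmod (\<Sum>z<Z. cnj (\<chi> y z) * \<beta> z))\<^sup>2)"
proof -
  let ?v = "vec (Z * Y) (\<lambda>i. \<alpha> (i mod Y) * \<beta> (i div Y))" and ?E = "block_proj Z Y \<chi>"
  define s where "s y = (\<Sum>z<Z. cnj (\<chi> y z) * \<beta> z)" for y
  have Ev: "(?E *\<^sub>v ?v) $ (z * Y + y) = \<chi> y z * \<alpha> y * s y" if "z < Z" "y < Y" for z y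
  proof -
    have lt: "z * Y + y < Z * Y" using that by (rule digits_less)
    have "(?E *\<^sub>v ?v) $ (z * Y + y) =
      (\<Sum>z'<Z. \<Sum>y'<Y. ?E $$ (z * Y + y, z' * Y + y') * ?v $ (z' * Y + y'))"
      by (subst mult_mat_vec_entry[OF block_proj_carrier _ lt]) (simp, simp only: sum_lessThan_mult)
    also have "\<dots> = (\<Sum>z'<Z. \<Sum>y'<Y. if y' = y then \<chi> y z * \<alpha> y * (cnj (\<chi> y z') * \<beta> z') else 0)"
      using lt that by (intro sum.cong refl) (auto simp: block_proj_def digits_less)
    also have "\<dots> = \<chi> y z * \<alpha> y * s y"
      using that by (simp add: s_def sum_distrib_left)
    finally show ?thesis .
  qed
  have "(?E *\<^sub>v ?v) \<bullet>c ?v = (\<Sum>z<Z. \<Sum>y<Y. (?E *\<^sub>v ?v) $ (z * Y + y) * cnj (?v $ (z * Y + y)))"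
    by (subst cscalar_prod_sum[of _ "Z * Y"])
      (use block_proj_carrier[of Z Y \<chi>] in \<open>auto intro!: carrier_vecI simp del: index_mult_mat_vec
        index_vec\<close>, simp only: sum_lessThan_mult)
  also have "\<dots> = (\<Sum>z<Z. \<Sum>y<Y. (\<alpha> y * cnj (\<alpha> y)) * (s y * cnj (cnj (\<chi> y z) * \<beta> z)))"
    by (intro sum.cong refl) (simp add: Ev digits_less)
  also have "\<dots> = (\<Sum>y<Y. (\<alpha> y * cnj (\<alpha> y)) * (s y * cnj (s y)))"
    by (subst sum.swap) (simp add: s_def sum_distrib_left)
  also have "\<dots> = (\<Sum>y<Y. (cmod (\<alpha> y))\<^sup>2 * (cmod (s y))\<^sup>2)"
    by (simp only: of_real_sum of_real_mult complex_norm_square)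
  finally show ?thesis by (simp add: s_def)
qed

section \<open>Hilbert--Schmidt inner product and distance\<close>

definition hs_inner :: "nat \<Rightarrow> complex mat \<Rightarrow> complex mat \<Rightarrow> complex" where
  "hs_inner N A B = (\<Sum>i<N. \<Sum>j<N. cnj (A $$ (i, j)) * B $$ (i, j))"

lemma frob_hs:
  assumes "A \<in> carrier_mat N N"
  shows "frob A = sqrt (Re (hs_inner N A A))"
proof -
  have "adj A \<in> carrier_mat N N" using assms by (auto simp: adj_def)
  then have "mtrace (adj A * A) = (\<Sum>j<N. \<Sum>i<N. cnj (A $$ (i, j)) * A $$ (i, j))"
    using assms unfolding mtrace_def
    by (intro sum.cong) (auto simp: mult_mat_entry[of _ N N _ N] adj_def simp del: index_mult_mat(1)
        intro!: sum.cong)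
  also have "\<dots> = hs_inner N A A"
    unfolding hs_inner_def by (rule sum.swap)
  finally show ?thesis by (simp add: frob_def)
qed

lemma hs_inner_self_nonneg: "Re (hs_inner N A A) \<ge> 0"
  by (simp add: hs_inner_def sum_nonneg)

lemma hs_inner_smult_minus:
  assumes A: "A \<in> carrier_mat N N" and B: "B \<in> carrier_mat N N" and c: "cmod c = 1"
  shows "Re (hs_inner N (c \<cdot>\<^sub>m A - B) (c \<cdot>\<^sub>m A - B)) =
    Re (hs_inner N A A) + Re (hs_inner N B B) - 2 * Re (c * hs_inner N B A)"
proof -
  have "Re (cnj (c * a - b) * (c * a - b)) =
    Re (cnj a * a) + Re (cnj b * b) - 2 * Re (c * (cnj b * a))" for a b
  proof -
    have "cnj (c * a - b) * (c * a - b) =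
      (c * cnj c) * (cnj a * a) + cnj b * b - (c * (cnj b * a) + cnj (c * (cnj b * a)))"
      by (simp add: algebra_simps)
    moreover have "c * cnj c = 1" using c by (simp add: complex_norm_square[symmetric])
    ultimately show ?thesis by (simp add: algebra_simps)
  qed
  then have "Re (hs_inner N (c \<cdot>\<^sub>m A - B) (c \<cdot>\<^sub>m A - B)) =
    (\<Sum>i<N. \<Sum>j<N. Re (cnj (A $$ (i, j)) * A $$ (i, j)) + Re (cnj (B $$ (i, j)) * B $$ (i, j))
      - 2 * Re (c * (cnj (B $$ (i, j)) * A $$ (i, j))))"
    unfolding hs_inner_def Re_sum using A B by (intro sum.cong refl) (auto simp del: complex_cnj_diff complex_cnj_mult)
  also have "\<dots> = Re (hs_inner N A A) + Re (hs_inner N B B) - 2 * Re (c * hs_inner N B A)"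
    unfolding hs_inner_def sum_distrib_left Re_sum sum_subtractf sum.distrib by simp
  finally show ?thesis .
qed

text \<open>Let \<open>t\<close> be \<open>hs_inner N B A\<close>. A phase that makes
  \<open>t\<close> real and nonnegative yields a value whose square is \<open>1 - |t| / N\<close>,
  and the infimum lies below that value.\<close>

lemma hs_inner_le_if_Dist_ge:
  assumes N: "N > 0" and A: "A \<in> carrier_mat N N" and B: "B \<in> carrier_mat N N"
    and AA: "hs_inner N A A = of_nat N" and BB: "hs_inner N B B = of_nat N"
    and \<epsilon>: "\<epsilon> > 0" "Dist N A B \<ge> \<epsilon>"
  shows "cmod (hs_inner N B A) / N \<le> 1 - \<epsilon>\<^sup>2"
proof -
  let ?t = "hs_inner N B A"
  obtain \<theta> where \<theta>: "\<theta> \<in> {0..<2 * pi}" "Re (exp (\<i> * complex_of_real \<theta>) * ?t) = cmod ?t"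
  proof (cases "?t = 0")
    case True
    then show ?thesis by (intro that[of 0]) auto
  next
    case False
    \<comment> \<open>The unit number that cancels the phase of \<open>?t\<close>; its angle is the
      required \<open>\<theta>\<close>.\<close>
    let ?c = "cnj ?t / cmod ?t"
    have "cmod ?c = 1" using False by (simp add: norm_divide)
    then have "(Re ?c)\<^sup>2 + (Im ?c)\<^sup>2 = 1" by (metis cmod_power2 power_one)
    then obtain \<theta> where t: "0 \<le> \<theta>" "\<theta> < 2 * pi" "Re ?c = cos \<theta>" "Im ?c = sin \<theta>"
      by (rule sincos_total_2pi)
    then have "exp (\<i> * complex_of_real \<theta>) = ?c"
      by (simp add: complex_eq_iff cis_conv_exp[symmetric])
    then have "exp (\<i> * complex_of_real \<theta>) * ?t = cmod ?t"
      using False by (simp add: complex_norm_square[symmetric] mult.commute power2_eq_square)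
    then show ?thesis using t by (intro that[of \<theta>]) auto
  qed
  let ?f = "\<lambda>\<theta>. frob (exp (\<i> * complex_of_real \<theta>) \<cdot>\<^sub>m A - B) / sqrt (2 * real N)"
  have frob: "frob (exp (\<i> * complex_of_real \<theta>) \<cdot>\<^sub>m A - B) =
      sqrt (Re (hs_inner N (exp (\<i> * complex_of_real \<theta>) \<cdot>\<^sub>m A - B) (exp (\<i> * complex_of_real \<theta>) \<cdot>\<^sub>m A - B)))" for \<theta>
    using A B by (intro frob_hs) auto
  have "bdd_below (?f ` {0..<2 * pi})"
    by (rule bdd_belowI[of _ 0]) (auto simp: frob hs_inner_self_nonneg)
  then have "Dist N A B \<le> ?f \<theta>"
    unfolding Dist_def using \<theta>(1) by (rule cINF_lower)
  then have "\<epsilon>\<^sup>2 \<le> (?f \<theta>)\<^sup>2"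
    using \<epsilon> by (intro power_mono) auto
  also have "\<dots> = (2 * real N - 2 * cmod ?t) / (2 * real N)"
  proof -
    have "Re (hs_inner N (exp (\<i> * complex_of_real \<theta>) \<cdot>\<^sub>m A - B) (exp (\<i> * complex_of_real \<theta>) \<cdot>\<^sub>m A - B)) =
      2 * real N - 2 * cmod ?t"
      using \<theta>(2) by (subst hs_inner_smult_minus[OF A B]) (auto simp: AA BB)
    then show ?thesis
      using hs_inner_self_nonneg[of N "exp (\<i> * complex_of_real \<theta>) \<cdot>\<^sub>m A - B"]
      by (simp add: power_divide frob)
  qed
  also have "\<dots> = 1 - cmod ?t / N" using N by (simp add: field_simps)
  finally show ?thesis by simp
qed

lemma unitary_column_norm:
  assumes "U \<in> unitaries N" "x < N"
  shows "(\<Sum>i<N. cnj (U $$ (i, x)) * U $$ (i, x)) = 1"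
proof -
  have U: "U \<in> carrier_mat N N" "adj U * U = 1\<^sub>m N" "adj U \<in> carrier_mat N N"
    using assms by (auto simp: unitaries_def adj_def)
  have "(\<Sum>i<N. cnj (U $$ (i, x)) * U $$ (i, x)) = (adj U * U) $$ (x, x)"
    unfolding mult_mat_entry[OF U(3,1) assms(2,2)] using U(1) assms(2)
    by (intro sum.cong) (auto simp: adj_def)
  then show ?thesis using U assms by simp
qed

lemma hs_inner_columns:
  assumes "\<And>x. x < N \<Longrightarrow> (\<Sum>i<N. cnj (U $$ (i, x)) * U $$ (i, x)) = 1"
  shows "hs_inner N U U = of_nat N"
  unfolding hs_inner_def by (subst sum.swap) (simp add: assms)

lemma adj_one_mat: "adj (1\<^sub>m N) = 1\<^sub>m N"
  by (rule eq_matI) (auto simp: adj_def)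

lemma one_mat_unitary: "1\<^sub>m N \<in> unitaries N"
  by (simp add: unitaries_def adj_one_mat)

section \<open>Registers of the tester\<close>

text \<open>System in basis state \<open>x\<close>, reference in basis state 0, which is the low
  digit of \<open>x * N\<close>.\<close>

definition basis_reg :: "nat \<Rightarrow> nat \<Rightarrow> nat \<Rightarrow> complex" where
  "basis_reg N x w = (if w = x * N then 1 else 0)"

text \<open>The maximally entangled state; a query turns it into the Choi state of
  \<open>U\<close>.\<close>

definition choi_reg :: "nat \<Rightarrow> nat \<Rightarrow> complex" where
  "choi_reg N w = (if w div N = w mod N then 1 / sqrt N else 0)"

lemma reg_apply_basis:
  assumes "x < N" "w < N * N"
  shows "reg_apply N U (basis_reg N x) w = (if w mod N = 0 then U $$ (w div N, x) else 0)"
proof -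
  have eq: "a * N + w mod N = x * N \<longleftrightarrow> a = x \<and> w mod N = 0" for a
  proof
    assume h: "a * N + w mod N = x * N"
    then have "(a * N + w mod N) div N = x" "(a * N + w mod N) mod N = 0"
      using assms by auto
    then show "a = x \<and> w mod N = 0" using assms by auto
  qed simp
  have "reg_apply N U (basis_reg N x) w =
      (\<Sum>a<N. if a = x then (if w mod N = 0 then U $$ (w div N, x) else 0) else 0)"
    unfolding reg_apply_def basis_reg_def eq by (intro sum.cong) auto
  then show ?thesis using assms by simp
qed

lemma reg_apply_choi:
  assumes "w < N * N"
  shows "reg_apply N U (choi_reg N) w = U $$ (w div N, w mod N) / sqrt N"
proof -
  have N: "N > 0" using assms by (cases N) auto
  have "reg_apply N U (choi_reg N) w =
      (\<Sum>a<N. if a = w mod N then U $$ (w div N, w mod N) / sqrt N else 0)"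
    unfolding reg_apply_def choi_reg_def using N by (intro sum.cong) auto
  then show ?thesis using N by simp
qed

lemma reg_apply_basis_norm:
  assumes "U \<in> unitaries N" "x < N"
  shows "(\<Sum>w<N * N. cnj (reg_apply N U (basis_reg N x) w) * reg_apply N U (basis_reg N x) w) = 1"
proof -
  have "(\<Sum>w<N * N. cnj (reg_apply N U (basis_reg N x) w) * reg_apply N U (basis_reg N x) w) =
    (\<Sum>s<N. \<Sum>r<N. if r = 0 then cnj (U $$ (s, x)) * U $$ (s, x) else 0)"
    unfolding sum_lessThan_mult using assms(2)
    by (intro sum.cong refl) (auto simp: reg_apply_basis digits_less)
  also have "\<dots> = (\<Sum>s<N. cnj (U $$ (s, x)) * U $$ (s, x))"
    using assms(2) by simp
  finally show ?thesis using unitary_column_norm[OF assms] by simp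
qed

text \<open>A queried Choi register stores the matrix entries scaled by \<open>1 / sqrt N\<close>,
  with the row in the system digit and the column in the reference digit, so overlaps of registers
  are overlaps of matrices.\<close>

lemma reg_apply_choi_inner:
  "(\<Sum>w<N * N. cnj (reg_apply N V (choi_reg N) w) * reg_apply N U (choi_reg N) w) =
    hs_inner N V U / N"
proof -
  have "complex_of_real (sqrt N) * complex_of_real (sqrt N) = of_nat N"
    by (metis of_real_mult of_real_of_nat_eq real_sqrt_mult_self abs_of_nat)
  then show ?thesis
    unfolding sum_lessThan_mult hs_inner_def sum_divide_distrib
    by (intro sum.cong refl) (auto simp: reg_apply_choi digits_less)
qed

lemma reg_apply_one:
  assumes "w < N * N"
  shows "reg_apply N (1\<^sub>m N) h w = h w"
proof -
  have lt: "w div N < N" using assms by (simp add: less_mult_imp_div_less)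
  have "reg_apply N (1\<^sub>m N) h w = (\<Sum>a<N. if a = w div N then h w else 0)"
    unfolding reg_apply_def using lt by (intro sum.cong) auto
  then show ?thesis using lt by simp
qed

section \<open>Qubit permutations\<close>

lemma qbit_bit: "qbit n x k = of_bool (bit x (n - k))"
  by (simp add: qbit_def bit_iff_odd mod_2_eq_odd)

lemma perm_op_column:
  assumes "c < 2 ^ n"
  shows "(\<Sum>r<2 ^ n. cnj (perm_op n \<tau> $$ (r, c)) * perm_op n \<tau> $$ (r, c)) = 1"
proof -
  \<comment> \<open>Bit \<open>i\<close> of an index is qubit \<open>n - i\<close>. The Horner sum
    lists bits from the least significant one and builds the only row at which column
    \<open>c\<close> has a 1.\<close>
  define r0 :: nat where "r0 = horner_sum of_bool 2 (map (\<lambda>i. bit c (n - \<tau> (n - i))) [0..<n])"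
  have lt: "r0 < 2 ^ n"
    unfolding r0_def using horner_sum_of_bool_2_less[of "map (\<lambda>i. bit c (n - \<tau> (n - i))) [0..<n]"] by simp
  have bit_r0: "bit r0 i \<longleftrightarrow> i < n \<and> bit c (n - \<tau> (n - i))" for i
    by (auto simp: r0_def bit_horner_sum_bit_iff)
  have "(\<forall>k\<in>{1..n}. qbit n r k = qbit n c (\<tau> k)) \<longleftrightarrow> r = r0" if r: "r < 2 ^ n" for r
  proof
    assume h: "\<forall>k\<in>{1..n}. qbit n r k = qbit n c (\<tau> k)"
    show "r = r0"
    proof (rule bit_eqI)
      fix i
      show "bit r i = bit r0 i"
      proof (cases "i < n")
        case True
        then have "qbit n r (n - i) = qbit n c (\<tau> (n - i))" using h by simp
        then show ?thesis using True by (simp add: qbit_bit bit_r0 of_bool_eq_iff)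
      next
        case False
        \<comment> \<open>Beyond position \<open>n - 1\<close> the bits of \<open>r\<close> vanish
          by \<open>r < 2 ^ n\<close> and those of \<open>r0\<close> by construction.\<close>
        have "take_bit n r = r" using r by (simp add: take_bit_nat_eq_self)
        then have "\<not> bit r i" using False by (metis bit_take_bit_iff)
        then show ?thesis using False by (simp add: bit_r0)
      qed
    qed
  next
    assume "r = r0"
    then show "\<forall>k\<in>{1..n}. qbit n r k = qbit n c (\<tau> k)"
      by (auto simp: qbit_bit bit_r0)
  qed
  then have "(\<Sum>r<2 ^ n. cnj (perm_op n \<tau> $$ (r, c)) * perm_op n \<tau> $$ (r, c)) =
    (\<Sum>r<2 ^ n. if r = r0 then 1 else 0)"
    using assms by (intro sum.cong) (auto simp: perm_op_def)
  then show ?thesis using lt by simp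
qed

lemma perm_op_carrier: "perm_op n \<tau> \<in> carrier_mat (2 ^ n) (2 ^ n)"
  by (simp add: perm_op_def)

lemma hs_inner_perm_op: "hs_inner (2 ^ n) (perm_op n \<tau>) (perm_op n \<tau>) = of_nat (2 ^ n)"
  by (rule hs_inner_columns) (rule perm_op_column)

text \<open>Qubit 1 is the most significant bit, so \<open>2 ^ (n - j)\<close> is the basis index with only qubit
  \<open>j\<close> set.\<close>

definition probe_regs :: "nat \<Rightarrow> (nat \<Rightarrow> complex) list" where
  "probe_regs n = map (\<lambda>j. basis_reg (2 ^ n) (2 ^ (n - j))) [1..<Suc n]"

lemma length_probe_regs [simp]: "length (probe_regs n) = n"
  by (simp add: probe_regs_def)

abbreviation probe_amplitude :: "nat \<Rightarrow> complex mat \<Rightarrow> nat \<Rightarrow> complex" where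
  "probe_amplitude n U \<equiv> tensor (2 ^ n * 2 ^ n) (map (reg_apply (2 ^ n) U) (probe_regs n))"

text \<open>If outcome \<open>y\<close> is possible for both operators, the probe with only qubit
  \<open>\<sigma> k\<close> set has a common output basis state. Its bit \<open>k\<close> is the
  input bit at \<open>\<sigma> k\<close>, which is 1, and also the input bit at
  \<open>\<tau> k\<close>. Only one input bit is set, so the positions agree.\<close>

lemma probe_determines_perm:
  assumes "\<sigma> permutes {1..n}" "\<tau> permutes {1..n}"
    and "probe_amplitude n (b \<cdot>\<^sub>m perm_op n \<sigma>) y \<noteq> 0"
    and "probe_amplitude n (c \<cdot>\<^sub>m perm_op n \<tau>) y \<noteq> 0"
  shows "\<sigma> = \<tau>"
proof
  fix k
  show "\<sigma> k = \<tau> k"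
  proof (cases "k \<in> {1..n}")
    case False
    then show ?thesis using assms by (simp add: permutes_not_in)
  next
    case True
    let ?N = "2 ^ n :: nat"
    define j where "j = \<sigma> k"
    have j: "j \<in> {1..n}" and tk: "\<tau> k \<in> {1..n}"
      using True assms permutes_in_image unfolding j_def by metis+
    then have x: "2 ^ (n - j) < ?N" by auto
    have "\<exists>w<?N * ?N. reg_apply ?N (b \<cdot>\<^sub>m perm_op n \<sigma>) (basis_reg ?N (2 ^ (n - j))) w \<noteq> 0 \<and>
      reg_apply ?N (c \<cdot>\<^sub>m perm_op n \<tau>) (basis_reg ?N (2 ^ (n - j))) w \<noteq> 0"
      using assms(3,4) j
      by (intro tensor_common_support[where js = "[1..<Suc n]" and i = y])
        (auto simp: probe_regs_def comp_def simp del: upt_Suc)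
    then obtain w where w: "w < ?N * ?N"
      and "reg_apply ?N (b \<cdot>\<^sub>m perm_op n \<sigma>) (basis_reg ?N (2 ^ (n - j))) w \<noteq> 0"
      and "reg_apply ?N (c \<cdot>\<^sub>m perm_op n \<tau>) (basis_reg ?N (2 ^ (n - j))) w \<noteq> 0"
      by blast
    moreover have s: "w div ?N < ?N" using w by (rule less_mult_imp_div_less)
    ultimately have "qbit n (w div ?N) k = qbit n (2 ^ (n - j)) (\<sigma> k)"
      "qbit n (w div ?N) k = qbit n (2 ^ (n - j)) (\<tau> k)"
      using x True by (auto simp: reg_apply_basis perm_op_def split: if_splits)
    then have "bit (2 ^ (n - j) :: nat) (n - \<tau> k) \<longleftrightarrow> bit (2 ^ (n - j) :: nat) (n - j)"
      by (simp add: qbit_bit j_def of_bool_eq_iff)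
    then have "n - \<tau> k = n - j" by (simp add: bit_exp_iff)
    \<comment> \<open>Truncated subtraction cancels here because \<open>j\<close> and
      \<open>\<tau> k\<close> are at most \<open>n\<close>.\<close>
    then show ?thesis using j tk by (auto simp: j_def)
  qed
qed

text \<open>At most one permutation gives outcome \<open>y\<close> nonzero amplitude, whatever the
  scalar \<open>c\<close>, so the guess can depend on \<open>y\<close> alone.\<close>

lemma obtain_perm_guess:
  obtains T where "\<And>y. T y permutes {1..n}"
    and "\<And>y \<sigma> c. \<sigma> permutes {1..n} \<Longrightarrow>
      probe_amplitude n (c \<cdot>\<^sub>m perm_op n \<sigma>) y \<noteq> 0 \<Longrightarrow> T y = \<sigma>"
proof -
  \<comment> \<open>Outcomes that no permutation can produce admit the identity as a
    default.\<close>
  have "\<forall>y. \<exists>\<tau>. \<tau> permutes {1..n} \<and>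
    (\<forall>\<sigma> c. \<sigma> permutes {1..n} \<longrightarrow> probe_amplitude n (c \<cdot>\<^sub>m perm_op n \<sigma>) y \<noteq> 0 \<longrightarrow> \<tau> = \<sigma>)"
    using probe_determines_perm permutes_id[of "{1..n}"] by metis
  from choice[OF this] obtain T where T: "\<forall>y. T y permutes {1..n} \<and>
    (\<forall>\<sigma> c. \<sigma> permutes {1..n} \<longrightarrow> probe_amplitude n (c \<cdot>\<^sub>m perm_op n \<sigma>) y \<noteq> 0 \<longrightarrow> T y = \<sigma>)" ..
  show ?thesis
    by (rule that[of T]) (use T in \<open>simp_all only:\<close>)
qed

section \<open>The tester\<close>

text \<open>The \<open>n + k\<close> registers have total dimension \<open>D ^ Suc l\<close>;
  \<open>anc_dim\<close> is this divided by the system dimension \<open>N\<close>, hence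
  \<open>l = n + k - 1\<close>. Probes come first in the list, so \<open>y\<close> occupies the low
  \<open>n\<close> digits, as \<open>block_proj\<close> expects.\<close>

definition tester :: "nat \<Rightarrow> nat \<Rightarrow> (nat \<Rightarrow> nat \<Rightarrow> nat) \<Rightarrow> alg" where
  "tester n k T = (let N = 2 ^ n; D = N * N; l = n + k - 1 in
    \<lparr>anc_dim = N * D ^ l,
     init_state = vec (D ^ Suc l) (tensor D (probe_regs n @ replicate k (choi_reg N))),
     ops = replicate (n + k) (select_mat (D ^ Suc l) (unrot D l)),
     accept_proj = block_proj (D ^ k) (D ^ n)
       (\<lambda>y. tensor D (replicate k (reg_apply N (perm_op n (T y)) (choi_reg N))))\<rparr>)"

lemma probe_norm:
  assumes "U \<in> unitaries (2 ^ n)"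
  shows "(\<Sum>y<(2 ^ n * 2 ^ n) ^ n. cnj (probe_amplitude n U y) * probe_amplitude n U y) = 1"
proof -
  have "(\<Sum>w<2 ^ n * 2 ^ n. cnj (h w) * h w) = 1"
    if h: "h \<in> set (map (reg_apply (2 ^ n) U) (probe_regs n))" for h
  proof -
    obtain j where j: "1 \<le> j" "j \<le> n" "h = reg_apply (2 ^ n) U (basis_reg (2 ^ n) (2 ^ (n - j)))"
      using h by (auto simp: probe_regs_def simp del: upt_Suc)
    then have "2 ^ (n - j) < (2::nat) ^ n" by auto
    then show ?thesis unfolding j(3) by (rule reg_apply_basis_norm[OF assms])
  qed
  then show ?thesis
    using tensor_norm[of "map (reg_apply (2 ^ n) U) (probe_regs n)" "2 ^ n * 2 ^ n"]
    by (simp only: length_map length_probe_regs)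
qed

lemma tester_valid:
  assumes n: "n > 0"
  shows "valid_alg (2 ^ n) (tester n k T)"
proof -
  define N :: nat where "N = 2 ^ n"
  define D where "D = N * N"
  define l where "l = n + k - 1"
  have Sl: "Suc l = n + k" using n by (simp add: l_def)
  have N: "N > 0" by (simp add: N_def)
  then have D: "D > 0" by (simp add: D_def)
  have dim: "N * (N * D ^ l) = D ^ Suc l" "D ^ Suc l = D ^ k * D ^ n"
    by (simp add: D_def) (simp only: Sl power_add mult.commute)
  let ?hs = "probe_regs n @ replicate k (choi_reg N)"
  have len: "length ?hs = Suc l" using Sl by simp
  have "(\<Sum>w<D. cnj (h w) * h w) = 1" if h: "h \<in> set ?hs" for h
  proof -
    \<comment> \<open>Every fresh register equals its image under a query to the identity, so the
      norms proved for queried registers apply.\<close>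
    have "(\<Sum>w<D. cnj (reg_apply N (1\<^sub>m N) h w) * reg_apply N (1\<^sub>m N) h w) = 1"
    proof (cases "h = choi_reg N")
      case True
      have "hs_inner N (1\<^sub>m N) (1\<^sub>m N) = of_nat N"
        by (intro hs_inner_columns unitary_column_norm one_mat_unitary)
      then show ?thesis using N True by (simp add: D_def reg_apply_choi_inner)
    next
      case False
      then obtain j where j: "1 \<le> j" "j \<le> n" "h = basis_reg N (2 ^ (n - j))"
        using h by (fastforce simp: probe_regs_def N_def simp del: upt_Suc)
      then have "2 ^ (n - j) < N" by (auto simp: N_def)
      then show ?thesis
        unfolding j(3) D_def by (intro reg_apply_basis_norm one_mat_unitary)
    qed
    then show ?thesis by (simp add: D_def reg_apply_one)
  qed
  with tensor_norm[of ?hs D]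
  have "vec (D ^ Suc l) (tensor D ?hs) \<bullet>c vec (D ^ Suc l) (tensor D ?hs) = 1"
    unfolding len by (subst cscalar_prod_sum[of _ "D ^ Suc l"]) (auto simp: mult.commute)
  moreover have "select_mat (D ^ Suc l) (unrot D l) \<in> unitaries (D ^ Suc l)"
    by (intro select_mat_unitary unrot_bij D)
  \<comment> \<open>A permutation operator has squared Hilbert-Schmidt norm \<open>N\<close>, so
    each of the \<open>k\<close> factors is 1.\<close>
  moreover have "(\<Sum>z<D ^ k. cnj (tensor D (replicate k (reg_apply N (perm_op n (T y)) (choi_reg N))) z) *
      tensor D (replicate k (reg_apply N (perm_op n (T y)) (choi_reg N))) z) = 1" for y
    using N unfolding tensor_inner_replicate D_def reg_apply_choi_inner
    by (simp add: N_def hs_inner_perm_op)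
  ultimately show ?thesis
    unfolding valid_alg_def tester_def Let_def N_def[symmetric] D_def[symmetric] l_def[symmetric]
    using N D
    by (auto simp: dim adj_block_proj simp del: power_Suc intro: block_proj_carrier block_proj_idem)
qed

text \<open>The final state is a pure tensor and splits at digit \<open>n\<close> into probes and
  Choi registers. Each of the \<open>k\<close> Choi registers contributes the same normalized
  overlap, and squaring the modulus gives the exponent \<open>2 * k\<close>.\<close>

lemma tester_accept_prob:
  assumes n: "n > 0" and U: "U \<in> unitaries (2 ^ n)"
  shows "accept_prob (tester n k T) U =
    (\<Sum>y<(2 ^ n * 2 ^ n) ^ n. (cmod (probe_amplitude n U y))\<^sup>2 *
      (cmod (hs_inner (2 ^ n) (perm_op n (T y)) U) / 2 ^ n) ^ (2 * k))"
proof -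
  define N :: nat where "N = 2 ^ n"
  define D where "D = N * N"
  define l where "l = n + k - 1"
  have Sl: "Suc l = n + k" using n by (simp add: l_def)
  have N: "N > 0" by (simp add: N_def)
  then have D: "D > 0" by (simp add: D_def)
  have UN: "U \<in> carrier_mat N N" using U by (simp add: unitaries_def N_def)
  have dim: "D ^ Suc l = D ^ k * D ^ n"
    by (simp only: Sl power_add mult.commute)
  let ?hs = "probe_regs n @ replicate k (choi_reg N)"
  let ?\<beta> = "tensor D (replicate k (reg_apply N U (choi_reg N)))"
  let ?\<chi> = "\<lambda>y. tensor D (replicate k (reg_apply N (perm_op n (T y)) (choi_reg N)))"
  let ?v = "vec (D ^ k * D ^ n) (\<lambda>i. probe_amplitude n U (i mod D ^ n) * ?\<beta> (i div D ^ n))"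
  have "final_state (tester n k T) U = vec (D ^ Suc l) (tensor D (map (reg_apply N U) ?hs))"
    using query_all_registers[OF UN N, of "[]" ?hs l, folded D_def] Sl
    unfolding final_state_def tester_def Let_def N_def[symmetric] D_def[symmetric] l_def[symmetric]
    by (simp del: power_Suc)
  also have "\<dots> = ?v"
    unfolding dim by (rule eq_vecI) (auto simp: tensor_append N_def D_def)
  finally have "accept_prob (tester n k T) U =
      Re ((block_proj (D ^ k) (D ^ n) ?\<chi> *\<^sub>v ?v) \<bullet>c ?v)"
    unfolding accept_prob_def by (simp add: tester_def Let_def N_def D_def)
  also have "\<dots> = (\<Sum>y<D ^ n. (cmod (probe_amplitude n U y))\<^sup>2 *
      (cmod (\<Sum>z<D ^ k. cnj (?\<chi> y z) * ?\<beta> z))\<^sup>2)"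
    using D by (subst block_proj_expectation) auto
  also have "\<dots> = (\<Sum>y<D ^ n. (cmod (probe_amplitude n U y))\<^sup>2 *
      (cmod (hs_inner N (perm_op n (T y)) U) / N) ^ (2 * k))"
    unfolding tensor_inner_replicate D_def reg_apply_choi_inner
    by (simp add: norm_power norm_divide power_mult[symmetric] mult.commute)
  finally show ?thesis by (simp add: N_def D_def)
qed

text \<open>Bernoulli makes \<open>(1 + x) ^ (2 * k)\<close> at least 3, while its product with
  \<open>(1 - x) ^ (2 * k)\<close> is a power of \<open>1 - x\<^sup>2\<close> and hence at most
  1.\<close>

lemma power_one_minus_le_third:
  fixes x :: real
  assumes "0 < x" "x \<le> 1" "1 \<le> real k * x"
  shows "(1 - x) ^ (2 * k) \<le> 1 / 3"
proof -
  have "3 \<le> 1 + real (2 * k) * x" using assms by simp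
  also have "\<dots> \<le> (1 + x) ^ (2 * k)" using assms by (intro Bernoulli_inequality) simp
  finally have "3 * (1 - x) ^ (2 * k) \<le> (1 + x) ^ (2 * k) * (1 - x) ^ (2 * k)"
    using assms by (intro mult_right_mono) auto
  also have "\<dots> = (1 - x\<^sup>2) ^ (2 * k)"
    by (simp add: power_mult_distrib[symmetric] algebra_simps power2_eq_square)
  also have "\<dots> \<le> 1" using assms by (intro power_le_one) (auto simp: power_le_one)
  finally show ?thesis by simp
qed

section \<open>Completeness and soundness of the tester\<close>

lemma probe_norm_real:
  assumes "U \<in> unitaries (2 ^ n)"
  shows "(\<Sum>y<(2 ^ n * 2 ^ n) ^ n. (cmod (probe_amplitude n U y))\<^sup>2) = 1"
proof -
  have "complex_of_real (\<Sum>y<(2 ^ n * 2 ^ n) ^ n. (cmod (probe_amplitude n U y))\<^sup>2) = 1"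
    using probe_norm[OF assms] by (simp only: of_real_sum complex_norm_square mult.commute)
  then show ?thesis by (simp only: of_real_eq_1_iff)
qed

lemma eps_far_hs_inner_le:
  assumes "\<epsilon> > 0" "U \<in> unitaries (2 ^ n)" "eps_far (2 ^ n) \<epsilon> (qubit_perms n) U"
    "\<tau> permutes {1..n}"
  shows "cmod (hs_inner (2 ^ n) (perm_op n \<tau>) U) / 2 ^ n \<le> 1 - \<epsilon>\<^sup>2"
proof -
  have "Dist (2 ^ n) U (perm_op n \<tau>) \<ge> \<epsilon>"
    using assms by (auto simp: eps_far_def qubit_perms_def)
  moreover have "hs_inner (2 ^ n) U U = of_nat (2 ^ n)"
    by (intro hs_inner_columns unitary_column_norm assms)
  ultimately show ?thesis
    using hs_inner_le_if_Dist_ge[of "2 ^ n" U "perm_op n \<tau>" \<epsilon>] assms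
    by (simp add: perm_op_carrier hs_inner_perm_op unitaries_def)
qed

lemma tester_eps_tests:
  assumes n: "n > 0" and \<epsilon>: "\<epsilon> > 0" "\<epsilon> \<le> 1" and k: "1 \<le> real k * \<epsilon>\<^sup>2"
    and T: "\<And>y. T y permutes {1..n}"
    and T_unique: "\<And>y \<sigma> c. \<sigma> permutes {1..n} \<Longrightarrow>
      probe_amplitude n (c \<cdot>\<^sub>m perm_op n \<sigma>) y \<noteq> 0 \<Longrightarrow> T y = \<sigma>"
  shows "eps_tests (2 ^ n) \<epsilon> (qubit_perms n) (tester n k T)"
  unfolding eps_tests_def
proof (intro conjI ballI impI)
  show "valid_alg (2 ^ n) (tester n k T)" by (rule tester_valid[OF n])
next
  fix U assume U: "U \<in> unitaries (2 ^ n)" and "has_property (qubit_perms n) U"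
  then obtain \<sigma> \<theta> where \<sigma>: "\<sigma> permutes {1..n}"
    and U_eq: "U = exp (\<i> * complex_of_real \<theta>) \<cdot>\<^sub>m perm_op n \<sigma>"
    by (auto simp: has_property_def qubit_perms_def)
  have "hs_inner (2 ^ n) (perm_op n \<sigma>) U =
      exp (\<i> * complex_of_real \<theta>) * hs_inner (2 ^ n) (perm_op n \<sigma>) (perm_op n \<sigma>)"
    unfolding hs_inner_def U_eq sum_distrib_left
    by (intro sum.cong refl) (auto simp: perm_op_def)
  then have "cmod (hs_inner (2 ^ n) (perm_op n \<sigma>) U) / 2 ^ n = 1"
    by (simp add: hs_inner_perm_op norm_mult norm_power)
  \<comment> \<open>A wrong guess occurs only at outcomes of amplitude zero, so every summand
    collapses to the outcome probability and the total is 1.\<close>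
  moreover have "probe_amplitude n U y = 0 \<or> T y = \<sigma>" for y
    using T_unique[OF \<sigma>, of "exp (\<i> * complex_of_real \<theta>)" y] U_eq by auto
  ultimately have "(cmod (probe_amplitude n U y))\<^sup>2 *
      (cmod (hs_inner (2 ^ n) (perm_op n (T y)) U) / 2 ^ n) ^ (2 * k) =
      (cmod (probe_amplitude n U y))\<^sup>2" for y
    by (metis mult_1_right mult_zero_left norm_zero power_one zero_power2)
  then show "2 / 3 \<le> accept_prob (tester n k T) U"
    by (simp only: tester_accept_prob[OF n U] probe_norm_real[OF U])
next
  fix U assume U: "U \<in> unitaries (2 ^ n)" and far: "eps_far (2 ^ n) \<epsilon> (qubit_perms n) U"
  \<comment> \<open>The bound 1/3 on the conditional acceptance probability is uniform in the guess
    \<open>T y\<close>, so averaging over outcomes preserves it.\<close>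
  have "accept_prob (tester n k T) U \<le>
      (\<Sum>y<(2 ^ n * 2 ^ n) ^ n. (cmod (probe_amplitude n U y))\<^sup>2 * (1 / 3))"
    unfolding tester_accept_prob[OF n U]
  proof (intro sum_mono mult_left_mono)
    fix y
    have "(cmod (hs_inner (2 ^ n) (perm_op n (T y)) U) / 2 ^ n) ^ (2 * k) \<le> (1 - \<epsilon>\<^sup>2) ^ (2 * k)"
      by (intro power_mono eps_far_hs_inner_le \<epsilon> U far T) auto
    also have "\<dots> \<le> 1 / 3"
      using \<epsilon> k by (intro power_one_minus_le_third) (auto simp: power_le_one)
    finally show "(cmod (hs_inner (2 ^ n) (perm_op n (T y)) U) / 2 ^ n) ^ (2 * k) \<le> 1 / 3" .
  qed auto
  also have "\<dots> = 1 / 3"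
    by (simp only: sum_distrib_right[symmetric] probe_norm_real[OF U] mult_1_left)
  finally show "accept_prob (tester n k T) U \<le> 1 / 3" .
qed

text \<open>The overlap bound at the identity permutation would force a nonnegative number below
  \<open>1 - \<epsilon>\<^sup>2 < 0\<close>, so nothing is far and accepting always is
  correct.\<close>

lemma trivial_tester:
  assumes "\<epsilon> > 1"
  shows "\<exists>A. eps_tests (2 ^ n) \<epsilon> (qubit_perms n) A \<and> num_queries A = 0"
proof -
  let ?A = "\<lparr>anc_dim = 1, init_state = unit_vec (2 ^ n) 0, ops = [], accept_proj = 1\<^sub>m (2 ^ n)\<rparr>"
  have "unit_vec (2 ^ n) 0 \<bullet>c unit_vec (2 ^ n) 0 = (\<Sum>i<2 ^ n. if i = (0::nat) then 1 else 0 :: complex)"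
    by (subst cscalar_prod_sum[of _ "2 ^ n"]) (rule unit_vec_carrier, intro sum.cong refl, simp)
  then have norm: "unit_vec (2 ^ n) 0 \<bullet>c unit_vec (2 ^ n) 0 = (1::complex)" by simp
  have "valid_alg (2 ^ n) ?A" by (simp add: valid_alg_def adj_one_mat norm)
  moreover have "accept_prob ?A U = 1" for U
    by (simp add: accept_prob_def final_state_def norm)
  moreover have "\<not> eps_far (2 ^ n) \<epsilon> (qubit_perms n) U" if "U \<in> unitaries (2 ^ n)" for U
  proof
    assume "eps_far (2 ^ n) \<epsilon> (qubit_perms n) U"
    then have "cmod (hs_inner (2 ^ n) (perm_op n id) U) / 2 ^ n \<le> 1 - \<epsilon>\<^sup>2"
      using assms that by (intro eps_far_hs_inner_le permutes_id) auto
    moreover have "0 \<le> cmod (hs_inner (2 ^ n) (perm_op n id) U) / 2 ^ n" by simp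
    moreover have "\<epsilon>\<^sup>2 > 1" using assms by (simp add: one_less_power)
    ultimately show False by linarith
  qed
  ultimately have "eps_tests (2 ^ n) \<epsilon> (qubit_perms n) ?A" by (auto simp: eps_tests_def)
  then show ?thesis by (intro exI[of _ ?A]) (simp add: num_queries_def)
qed

theorem theorem5:
  shows "\<exists>C>0. \<forall>n\<ge>2. \<forall>\<epsilon>>0. \<exists>A.
     eps_tests (2^n) \<epsilon> (qubit_perms n) A \<and>
     real (num_queries A) \<le> C * real n * ln (real n) / \<epsilon>^2"
proof (intro exI[of _ "2 / ln 2"] conjI allI impI)
  show "(0::real) < 2 / ln 2" by simp
next
  fix n :: nat and \<epsilon> :: real
  assume n: "2 \<le> n" and \<epsilon>: "0 < \<epsilon>"
  \<comment> \<open>The constant \<open>2 / ln 2\<close> combines the factor 2 of the query count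
    with the value of \<open>ln n\<close> at the smallest case \<open>n = 2\<close>.\<close>
  have "ln 2 \<le> ln (real n)" using n by simp
  then have "2 * real n \<le> 2 / ln 2 * real n * ln (real n)"
    using n by (simp add: field_simps)
  then have bound: "2 * real n / \<epsilon>\<^sup>2 \<le> 2 / ln 2 * real n * ln (real n) / \<epsilon>\<^sup>2"
    by (intro divide_right_mono) auto
  show "\<exists>A. eps_tests (2^n) \<epsilon> (qubit_perms n) A \<and>
     real (num_queries A) \<le> 2 / ln 2 * real n * ln (real n) / \<epsilon>^2"
  proof (cases "\<epsilon> \<le> 1")
    case False
    then obtain A where "eps_tests (2 ^ n) \<epsilon> (qubit_perms n) A" "num_queries A = 0"
      using trivial_tester[of \<epsilon> n] by auto
    then show ?thesis using n by (intro exI[of _ A]) auto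
  next
    case True
    \<comment> \<open>The least number of copies with
      \<open>1 \<le> k * \<epsilon>\<^sup>2\<close>.\<close>
    define k where "k = nat \<lceil>1 / \<epsilon>\<^sup>2\<rceil>"
    have e2: "0 < \<epsilon>\<^sup>2" "\<epsilon>\<^sup>2 \<le> 1" using \<epsilon> True by (auto simp: power_le_one)
    have "1 / \<epsilon>\<^sup>2 \<le> real k" by (simp add: k_def)
    then have k: "1 \<le> real k * \<epsilon>\<^sup>2" using e2 by (simp add: field_simps)
    have "real k \<le> 1 / \<epsilon>\<^sup>2 + 1" unfolding k_def using e2 of_int_ceiling_le_add_one[of "1 / \<epsilon>\<^sup>2"] by simp
    \<comment> \<open>After multiplication by \<open>\<epsilon>\<^sup>2 \<le> 1\<close> the count is
      at most \<open>n + 2\<close>, and \<open>n \<ge> 2\<close> bounds this by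
      \<open>2 * n\<close>.\<close>
    then have "real (n + k) * \<epsilon>\<^sup>2 \<le> (real n + 1 + 1 / \<epsilon>\<^sup>2) * \<epsilon>\<^sup>2"
      using e2 by (intro mult_right_mono) auto
    also have "\<dots> = (real n + 1) * \<epsilon>\<^sup>2 + 1" using e2 by (simp add: field_simps)
    also have "\<dots> \<le> (real n + 1) * 1 + 1" using e2 by (intro add_right_mono mult_left_mono) auto
    also have "\<dots> \<le> 2 * real n" using n by simp
    finally have q: "real (n + k) \<le> 2 * real n / \<epsilon>\<^sup>2" using e2 by (simp add: field_simps)
    show ?thesis
    proof (rule obtain_perm_guess[of n])
      fix T
      assume T: "\<And>y. T y permutes {1..n}"
        "\<And>y \<sigma> c. \<sigma> permutes {1..n} \<Longrightarrow> probe_amplitude n (c \<cdot>\<^sub>m perm_op n \<sigma>) y \<noteq> 0 \<Longrightarrow> T y = \<sigma>"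
      have "eps_tests (2 ^ n) \<epsilon> (qubit_perms n) (tester n k T)"
        using n by (intro tester_eps_tests \<epsilon> True k T) auto
      moreover have "num_queries (tester n k T) = n + k"
        by (simp add: num_queries_def tester_def Let_def)
      ultimately show ?thesis using q bound by (intro exI[of _ "tester n k T"]) auto
    qed
  qed
qed

end
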